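(* Let $1\leq p<\infty$ and let $E$ be a locally convex space. If $\gamma\in L^p([0,1],E)$, then for each $\varepsilon>0$ and each continuous seminorm $q$ on $E$, there exists a simple function $\beta_{\varepsilon,q}:[0,1]\to E$ such that \[ \lVert \gamma-\beta_{\varepsilon,q}\rVert_{\mathcal{L}^p,q}<\varepsilon. \] Consequently, the space of simple functions $\mathcal{S}([0,1],E)$ is dense in $L^p([0,1],E)$.
   Context: All locally convex spaces are real and not necessarily Hausdorff. $\lambda$ is Lebesgue measure on $[0,1]$ and $\mathcal{L}([0,1])$ the Lebesgue $\sigma$-algebra. A function $\gamma:[0,1]\to E$ is Lusin-measurable if for each $\varepsilon>0$ there is a compact $K_\varepsilon\subseteq[0,1]$ with $\lambda([0,1]\setminus K_\varepsilon)\leq\varepsilon$ and $\gamma|_{K_\varepsilon}$ continuous. A function $\beta:[0,1]\to E$ is simple if $\beta=\sum_{i=1}^n y_i\chi_{A_i}$ for some $y_1,\dots,y_n\in E$ and $A_1,\dots,A_n\in\mathcal{L}([0,1])$, where $\chi_A$ denotes the characteristic function of $A$; $\mathcal{S}([0,1],E)$ is the vector space of simple functions. $\mathcal{L}^p([0,1],E)$ is the set of Lusin-measurable $\gamma:[0,1]\to E$ such that $q\circ\gamma\in\mathcal{L}^p([0,1],\mathbb{R})$ for each continuous seminorm $q$ on $E$. $L^p([0,1],E)$ is its quotient by almost everywhere equality (a function is identified with its class), with the locally convex topology defined by the seminorms $\lVert\gamma\rVert_{\mathcal{L}^p,q}=\left(\int_0^1 q(\gamma(t))^p\,dt\right)^{1/p}$,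 where $q$ ranges over the continuous seminorms on $E$. *)

theory Defs
  imports "HOL-Analysis.Analysis"
begin

text \<open>
  Real locally convex spaces. No separation axiom is imposed, so the spaces need not be Hausdorff.
\<close>

class locally_convex_space = real_vector + topological_ab_group_add +
  assumes tendsto_scaleR_Pair:
    "LIM x (nhds c \<times>\<^sub>F nhds a). fst x *\<^sub>R snd x :> nhds (c *\<^sub>R a)"
  assumes convex_nhds_base_raw:
    "open U \<Longrightarrow> 0 \<in> U \<Longrightarrow>
       \<exists>V. (\<forall>x\<in>V. \<forall>y\<in>V. \<forall>u\<ge>0. \<forall>v\<ge>0. u + v = 1 \<longrightarrow> u *\<^sub>R x + v *\<^sub>R y \<in> V) \<and>
           eventually (\<lambda>x. x \<in> V) (nhds 0) \<and> V \<subseteq> U"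
    \<comment> \<open>convexity is written out since \<^const>\<open>convex\<close> cannot be used in the class specification\<close>

lemma convex_nhds_base:
  fixes U :: "'a::locally_convex_space set"
  assumes "open U" "0 \<in> U"
  shows "\<exists>V. convex V \<and> eventually (\<lambda>x. x \<in> V) (nhds 0) \<and> V \<subseteq> U"
  using convex_nhds_base_raw[OF assms] unfolding convex_def by blast

instance real_normed_vector \<subseteq> locally_convex_space
proof
  fix c :: real and a :: 'a
  show "LIM x (nhds c \<times>\<^sub>F nhds a). fst x *\<^sub>R snd x :> nhds (c *\<^sub>R a)"
    by (intro tendsto_scaleR filterlim_fst filterlim_snd)
next
  fix U :: "'a set"
  assume "open U" "0 \<in> U"
  then obtain e where e: "e > 0" "ball 0 e \<subseteq> U"
    by (auto simp: open_contains_ball)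
  have "eventually (\<lambda>x. x \<in> ball (0::'a) e) (nhds 0)"
    using e(1) by (intro eventually_nhds_in_open) auto
  moreover have "convex (ball (0::'a) e)"
    by simp
  ultimately show "\<exists>V. (\<forall>x\<in>V. \<forall>y\<in>V. \<forall>u\<ge>0. \<forall>v\<ge>0. u + v = 1 \<longrightarrow> u *\<^sub>R x + v *\<^sub>R y \<in> V) \<and>
      eventually (\<lambda>x. x \<in> V) (nhds 0) \<and> V \<subseteq> U"
    using e(2) unfolding convex_def by blast
qed

definition continuous_seminorm :: "('e::locally_convex_space \<Rightarrow> real) \<Rightarrow> bool" where
  "continuous_seminorm q \<longleftrightarrow>
     (\<forall>x. 0 \<le> q x) \<and>
     (\<forall>x y. q (x + y) \<le> q x + q y) \<and>
     (\<forall>c x. q (c *\<^sub>R x) = \<bar>c\<bar> * q x) \<and>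
     continuous_on UNIV q"

text \<open>
  A function $[0,1] \to E$ is represented by a function on all of \<^typ>\<open>real\<close>; every notion below
  depends only on its restriction to \<^term>\<open>{0..1::real}\<close>.
\<close>

definition lusin_measurable :: "(real \<Rightarrow> 'e::locally_convex_space) \<Rightarrow> bool" where
  "lusin_measurable \<gamma> \<longleftrightarrow>
     (\<forall>\<epsilon>>0. \<exists>K. compact K \<and> K \<subseteq> {0..1} \<and>
        measure lebesgue ({0..1} - K) \<le> \<epsilon> \<and> continuous_on K \<gamma>)"

definition simple_functions :: "(real \<Rightarrow> 'e::locally_convex_space) set" where
  "simple_functions =
     {\<beta>. \<exists>(n::nat) y A. (\<forall>i\<in>{1..n}. A i \<in> sets (lebesgue_on {0..1})) \<and>
        (\<forall>t\<in>{0..1}. \<beta> t = (\<Sum>i=1..n. indicat_real (A i) t *\<^sub>R y i))}"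

definition real_Lp_functions :: "real \<Rightarrow> (real \<Rightarrow> real) set" where
  "real_Lp_functions p =
     {f \<in> borel_measurable (lebesgue_on {0..1}).
        integrable (lebesgue_on {0..1}) (\<lambda>t. \<bar>f t\<bar> powr p)}"

definition Lp_functions :: "real \<Rightarrow> (real \<Rightarrow> 'e::locally_convex_space) set" where
  "Lp_functions p =
     {\<gamma>. lusin_measurable \<gamma> \<and>
        (\<forall>q. continuous_seminorm q \<longrightarrow> (\<lambda>t. q (\<gamma> t)) \<in> real_Lp_functions p)}"

definition Lp_seminorm ::
    "real \<Rightarrow> ('e::locally_convex_space \<Rightarrow> real) \<Rightarrow> (real \<Rightarrow> 'e) \<Rightarrow> real" where
  "Lp_seminorm p q \<gamma> = (LINT t|lebesgue_on {0..1}. q (\<gamma> t) powr p) powr (1 / p)"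

definition ae_eq :: "real \<Rightarrow> ((real \<Rightarrow> 'e::locally_convex_space) \<times> (real \<Rightarrow> 'e)) set" where
  "ae_eq p =
     {(\<gamma>, \<eta>). \<gamma> \<in> Lp_functions p \<and> \<eta> \<in> Lp_functions p \<and>
        (AE t in lebesgue_on {0..1}. \<gamma> t = \<eta> t)}"

definition Lp_class :: "real \<Rightarrow> (real \<Rightarrow> 'e::locally_convex_space) \<Rightarrow> (real \<Rightarrow> 'e) set" where
  "Lp_class p \<gamma> = ae_eq p `` {\<gamma>}"

definition Lp_space :: "real \<Rightarrow> (real \<Rightarrow> 'e::locally_convex_space) set set" where
  "Lp_space p = Lp_functions p // ae_eq p"

definition Lp_ball ::
    "real \<Rightarrow> ('e::locally_convex_space \<Rightarrow> real) \<Rightarrow> (real \<Rightarrow> 'e) \<Rightarrow> real \<Rightarrow> (real \<Rightarrow> 'e) set set" where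
  "Lp_ball p q \<gamma> r =
     Lp_class p ` {\<eta> \<in> Lp_functions p. Lp_seminorm p q (\<lambda>t. \<eta> t - \<gamma> t) < r}"

text \<open>
  The locally convex topology on $L^p$ defined by the seminorms \<^const>\<open>Lp_seminorm\<close>: it has the
  open seminorm balls, for all continuous seminorms on the space of values, as a subbasis.
\<close>

definition Lp_topology :: "real \<Rightarrow> (real \<Rightarrow> 'e::locally_convex_space) set topology" where
  "Lp_topology p =
     topology_generated_by
       {Lp_ball p q \<gamma> r | q \<gamma> r. continuous_seminorm q \<and> \<gamma> \<in> Lp_functions p \<and> r > 0}"

end

theory Submission
  imports Defs
begin

text \<open>
  Given \<gamma>, Lusin measurability provides a compact K on which \<gamma> is continuous, outside of which
  \<gamma> contributes little to the integral by absolute continuity. Finitely many balls of the seminorm q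
  cover the compact image of K; disjointifying their preimages gives a simple function that vanishes
  off K and is uniformly q-close to \<gamma> on K. Every neighbourhood of a class in Lp contains a ball of a
  single seminorm, because the sum of two continuous seminorms is again one and because of Minkowski's
  inequality; hence density follows.
\<close>

section \<open>Convexity of powers and absolute continuity of the integral\<close>

text \<open>Convexity of the power function, scaled so that Minkowski's inequality follows by integration.\<close>

lemma powr_add_le:
  fixes a b x y p :: real
  assumes "1 \<le> p" "0 < a" "0 < b" "0 \<le> x" "0 \<le> y"
  shows "((x + y) / (a + b)) powr p \<le>
           a / (a + b) * (x / a) powr p + b / (a + b) * (y / b) powr p"
proof -
  define u v where "u = a / (a + b)" and "v = b / (a + b)"
  define s t where "s = x / a" and "t = y / b"
  have uv: "0 < u" "0 < v" "u + v = 1" and st: "0 \<le> s" "0 \<le> t"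
    using assms by (auto simp: u_def v_def s_def t_def add_divide_distrib[symmetric])
  have eq: "(x + y) / (a + b) = u * s + v * t"
    using assms by (simp add: u_def v_def s_def t_def add_divide_distrib)
  have le: "w powr p \<le> w" if "0 < w" "w \<le> 1" for w :: real
    using powr_mono'[of 1 p w] that assms(1) by simp
  \<comment> \<open>If \<open>s\<close> or \<open>t\<close> vanishes, the claim reduces to this
    bound, which rests on \<open>w powr p \<le> w\<close> for weights in (0,1]. Convexity of the
    power function is then invoked only at two positive points.\<close>
  have scale: "(w * z) powr p \<le> w * z powr p" if "0 < w" "w \<le> 1" "0 \<le> z" for w z :: real
    using le[of w] that by (simp add: powr_mult mult_right_mono)
  have "(u * s + v * t) powr p \<le> u * s powr p + v * t powr p"
  proof (cases "s = 0 \<or> t = 0")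
    case True
    then show ?thesis
    proof
      assume "s = 0"
      then show ?thesis using uv st scale[of v t] assms(1) by simp
    next
      assume "t = 0"
      then show ?thesis using uv st scale[of u s] assms(1) by simp
    qed
  next
    case False
    have u: "u = 1 - v"
      using uv by simp
    show ?thesis
      using convex_onD[OF powr_convex[OF assms(1)], of v s t] uv st False by (simp add: u)
  qed
  then show ?thesis
    by (simp add: eq u_def v_def s_def t_def)
qed

text \<open>Truncation: the excess of \<open>f\<close> over height n is dominated by
  \<open>f\<close> and tends to 0 pointwise, so its integral is below \<open>e / 2\<close> for some
  height N. The part of \<open>f\<close> below N contributes at most N times the measure of the
  set.\<close>

lemma (in finite_measure) integral_absolutely_continuous:
  fixes f :: "'a \<Rightarrow> real"
  assumes f: "integrable M f" "\<And>t. 0 \<le> f t" and e: "0 < e"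
  obtains d where "0 < d"
    "\<And>A. A \<in> sets M \<Longrightarrow> measure M A \<le> d \<Longrightarrow> (LINT t|M. indicator A t * f t) < e"
proof -
  have [measurable]: "f \<in> borel_measurable M"
    using f by auto
  have int: "integrable M (\<lambda>t. f t - min (f t) (real n))" for n
    by (rule Bochner_Integration.integrable_bound[OF f(1)]) (auto simp: f)
  have lim: "(\<lambda>n. f t - min (f t) (real n)) \<longlonglongrightarrow> 0" for t
  proof (rule tendsto_eventually)
    obtain N where "f t \<le> real N"
      using real_arch_simple by blast
    then show "\<forall>\<^sub>F n in sequentially. f t - min (f t) (real n) = 0"
      by (intro eventually_sequentiallyI[of N]) (simp add: min_def)
  qed
  have "(\<lambda>n. LINT t|M. f t - min (f t) (real n)) \<longlonglongrightarrow> (LINT t|M. 0)"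
    by (rule integral_dominated_convergence[where w=f]) (use f lim in auto)
  then have "\<forall>\<^sub>F n in sequentially. (LINT t|M. f t - min (f t) (real n)) < e / 2"
    using e by (intro order_tendstoD(2)) auto
  then obtain N where N: "(LINT t|M. f t - min (f t) (real N)) < e / 2"
    by (auto simp: eventually_sequentially)
  show ?thesis
  proof
    \<comment> \<open>The summand 1 avoids division by zero when N = 0, and N times this constant is
      still at most \<open>e / 2\<close>.\<close>
    show "0 < e / (2 * (real N + 1))"
      using e by simp
    fix A assume A[measurable]: "A \<in> sets M" and small: "measure M A \<le> e / (2 * (real N + 1))"
    have intA: "integrable M (\<lambda>t. real N * indicator A t)"
      by (simp add: emeasure_finite less_top[symmetric])
    have "(LINT t|M. indicator A t * f t) \<le>
          (LINT t|M. (f t - min (f t) (real N)) + real N * indicator A t)"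
      by (intro integral_mono' Bochner_Integration.integrable_add int intA)
        (auto simp: f indicator_def)
    also have "\<dots> = (LINT t|M. f t - min (f t) (real N)) + real N * measure M A"
      using int[of N] intA by simp
    also have "real N * measure M A \<le> real N * (e / (2 * (real N + 1)))"
      using small by (intro mult_left_mono) auto
    also have "\<dots> \<le> e / 2"
      using e by (simp add: field_simps)
    finally show "(LINT t|M. indicator A t * f t) < e"
      using N by linarith
  qed
qed

section \<open>The measure space on the unit interval and continuous seminorms\<close>

lemma finite_measure_unit_interval: "finite_measure (lebesgue_on {0..1::real})"
  by (rule finite_measure_lebesgue_on) simp

lemma sets_lebesgue_unit_interval:
  "A \<in> sets (lebesgue_on {0..1::real}) \<longleftrightarrow> A \<subseteq> {0..1} \<and> A \<in> sets lebesgue"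
  by (simp add: sets_restrict_space_iff)

lemma continuous_seminormD:
  assumes "continuous_seminorm q"
  shows "0 \<le> q x" "q (x + y) \<le> q x + q y" "q (c *\<^sub>R x) = \<bar>c\<bar> * q x" "continuous_on S q"
  using assms continuous_on_subset unfolding continuous_seminorm_def by blast+

lemma continuous_seminorm_zero:
  assumes "continuous_seminorm q"
  shows "q 0 = 0"
  using continuous_seminormD(3)[OF assms, of 0 0] by simp

lemma continuous_seminorm_minus:
  assumes "continuous_seminorm q"
  shows "q (- x) = q x"
  using continuous_seminormD(3)[OF assms, of "-1" x] by simp

lemma continuous_seminorm_diff:
  assumes "continuous_seminorm q"
  shows "q (x - y) \<le> q x + q y"
  using continuous_seminormD(2)[OF assms, of x "- y"] continuous_seminorm_minus[OF assms, of y]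
  by simp

text \<open>Serves to merge two seminorm balls with a common centre: the sum dominates both
  seminorms, so one of its balls lies in the intersection.\<close>

lemma continuous_seminorm_add:
  assumes "continuous_seminorm q" "continuous_seminorm q'"
  shows "continuous_seminorm (\<lambda>x. q x + q' x)"
  unfolding continuous_seminorm_def
proof (intro conjI allI)
  note q = continuous_seminormD[OF assms(1)] and q' = continuous_seminormD[OF assms(2)]
  show "0 \<le> q x + q' x" for x
    using q(1) q'(1) by simp
  show "q (x + y) + q' (x + y) \<le> (q x + q' x) + (q y + q' y)" for x y
    using q(2)[of x y] q'(2)[of x y] by simp
  show "q (c *\<^sub>R x) + q' (c *\<^sub>R x) = \<bar>c\<bar> * (q x + q' x)" for c x
    by (simp add: q(3) q'(3) distrib_left)
  show "continuous_on UNIV (\<lambda>x. q x + q' x)"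
    by (intro continuous_on_add q(4) q'(4))
qed

section \<open>Lusin-measurable functions\<close>

text \<open>Intersecting the compact sets of the two functions, each chosen for
  \<open>e / 2\<close>, loses at most the sum of both defects.\<close>

lemma lusin_measurable_diff:
  fixes f g :: "real \<Rightarrow> 'e::locally_convex_space"
  assumes "lusin_measurable f" "lusin_measurable g"
  shows "lusin_measurable (\<lambda>t. f t - g t)"
  unfolding lusin_measurable_def
proof safe
  fix e :: real assume "0 < e"
  then have "0 < e / 2" by simp
  then obtain K L where K: "compact K" "K \<subseteq> {0..1}" "measure lebesgue ({0..1} - K) \<le> e / 2"
      "continuous_on K f"
    and L: "compact L" "L \<subseteq> {0..1}" "measure lebesgue ({0..1} - L) \<le> e / 2" "continuous_on L g"
    using assms unfolding lusin_measurable_def by meson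
  have lm: "{0..1} - K \<in> lmeasurable" "{0..1} - L \<in> lmeasurable"
    using K(1) L(1) by (simp_all add: fmeasurable.Diff lmeasurable_compact)
  have "measure lebesgue ({0..1} - K \<inter> L) \<le> measure lebesgue ({0..1} - K) + measure lebesgue ({0..1} - L)"
    using measure_Un_le[of "{0..1} - K" lebesgue "{0..1} - L"] lm by (simp add: Diff_Int fmeasurableD)
  then have "measure lebesgue ({0..1} - K \<inter> L) \<le> e"
    using K(3) L(3) by simp
  moreover have "continuous_on (K \<inter> L) (\<lambda>t. f t - g t)"
    using K(4) L(4) by (intro continuous_on_diff) (auto elim: continuous_on_subset)
  ultimately show "\<exists>K. compact K \<and> K \<subseteq> {0..1} \<and> measure lebesgue ({0..1} - K) \<le> e \<and>
      continuous_on K (\<lambda>t. f t - g t)"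
    using K L by (intro exI[of _ "K \<inter> L"]) (auto intro: compact_Int)
qed

text \<open>Compact sets with defect at most 1/(n+1) exhaust [0,1] up to a null set. On each of them
  the preimage of an open set is relatively open, hence Borel. The lemma is what makes
  \<open>q\<close> of a difference measurable, which does not follow from measurability of
  \<open>q\<close> along each of the two functions.\<close>

lemma lusin_measurable_imp_borel_measurable:
  fixes h :: "'e::locally_convex_space \<Rightarrow> real"
  assumes "lusin_measurable f" "continuous_on UNIV h"
  shows "(\<lambda>t. h (f t)) \<in> borel_measurable (lebesgue_on {0..1})"
proof (rule borel_measurableI)
  fix S :: "real set" assume "open S"
  have "\<forall>n::nat. \<exists>K. compact K \<and> K \<subseteq> {0..1} \<and> measure lebesgue ({0..1} - K) \<le> 1 / Suc n \<and>
      continuous_on K f"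
    using assms(1) unfolding lusin_measurable_def by simp
  then obtain K where K: "\<And>n::nat. compact (K n)" "\<And>n. K n \<subseteq> {0..1}"
      "\<And>n. measure lebesgue ({0..1} - K n) \<le> 1 / Suc n" "\<And>n. continuous_on (K n) f"
    by metis
  have borel: "K n \<in> sets borel" for n
    using K(1) by (simp add: borel_compact)
  have good: "K n \<inter> (\<lambda>t. h (f t)) -` S \<in> sets borel" for n
  proof -
    have "continuous_on (K n) (\<lambda>t. h (f t))"
      using continuous_on_compose2[OF assms(2) K(4)] by simp
    then obtain V where "open V" "V \<inter> K n = (\<lambda>t. h (f t)) -` S \<inter> K n"
      using \<open>open S\<close> unfolding continuous_on_open_invariant by blast
    then show ?thesis
      using borel[of n] by (metis Int_commute borel_open sets.Int)
  qed
  define N where "N = {0..1} - (\<Union>n. K n)"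
  have N: "N \<in> sets lebesgue"
    unfolding N_def using borel by auto
  have "measure lebesgue N \<le> 1 / Suc n" for n
  proof -
    have "{0..1} - K n \<in> lmeasurable"
      using K(1) by (simp add: fmeasurable.Diff lmeasurable_compact)
    then have "measure lebesgue N \<le> measure lebesgue ({0..1} - K n)"
      using N by (intro measure_mono_fmeasurable) (auto simp: N_def)
    then show ?thesis
      using K(3)[of n] by linarith
  qed
  then have "measure lebesgue N \<le> 0"
    using LIMSEQ_inverse_real_of_nat
    by (intro LIMSEQ_le_const[of "\<lambda>n. inverse (real (Suc n))"]) (auto simp: inverse_eq_divide)
  moreover have "N \<in> lmeasurable"
    using N by (intro fmeasurableI2[of "{0..1}" lebesgue N]) (auto simp: N_def)
  ultimately have "N \<in> null_sets lebesgue"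
    using measure_nonneg[of lebesgue N] by (intro null_setsI) (auto simp: emeasure_eq_measure2)
  \<comment> \<open>Nothing is known about the function on \<open>N\<close>; completeness of
    Lebesgue measure makes every subset of the null set measurable.\<close>
  then have 1: "N \<inter> (\<lambda>t. h (f t)) -` S \<in> sets lebesgue"
    using null_sets_completion_subset[of "N \<inter> (\<lambda>t. h (f t)) -` S" N lborel] by blast
  have "(\<Union>n. K n \<inter> (\<lambda>t. h (f t)) -` S) \<in> sets borel"
    by (rule sets.countable_UN') (use good in auto)
  then have 2: "(\<Union>n. K n \<inter> (\<lambda>t. h (f t)) -` S) \<in> sets lebesgue"
    by (rule sets_completionI_sets[of _ lborel, simplified])
  have "(\<lambda>t. h (f t)) -` S \<inter> {0..1} =
      (\<Union>n. K n \<inter> (\<lambda>t. h (f t)) -` S) \<union> (N \<inter> (\<lambda>t. h (f t)) -` S)"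
    using K(2) by (auto simp: N_def)
  then have "(\<lambda>t. h (f t)) -` S \<inter> {0..1} \<in> sets lebesgue"
    using sets.Un[OF 2 1] by (rule ssubst)
  then show "(\<lambda>t. h (f t)) -` S \<inter> space (lebesgue_on {0..1}) \<in> sets (lebesgue_on {0..1})"
    by (simp add: sets_lebesgue_unit_interval)
qed

section \<open>Simple functions\<close>

text \<open>Bridge from sums over possibly overlapping sets to the library notion of finite range
  with measurable fibres, whose closure rules are used later. Conversely, the finitely many values
  are enumerated and the fibres serve as the sets.\<close>

lemma simple_functions_iff:
  fixes \<beta> :: "real \<Rightarrow> 'e::locally_convex_space"
  shows "\<beta> \<in> simple_functions \<longleftrightarrow> simple_function (lebesgue_on {0..1}) \<beta>"
proof
  assume "\<beta> \<in> simple_functions"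
  then obtain n :: nat and y A where A: "\<And>i. i \<in> {1..n} \<Longrightarrow> A i \<in> sets (lebesgue_on {0..1})"
    and \<beta>: "\<And>t. t \<in> {0..1} \<Longrightarrow> \<beta> t = (\<Sum>i=1..n. indicat_real (A i) t *\<^sub>R y i)"
    unfolding simple_functions_def by blast
  have "simple_function (lebesgue_on {0..1}) (\<lambda>t. \<Sum>i\<in>I. indicat_real (A i) t *\<^sub>R y i)"
    if "finite I" "I \<subseteq> {1..n}" for I
    using that
  proof (induction I)
    case (insert i I)
    then have "simple_function (lebesgue_on {0..1}) (\<lambda>t. indicat_real (A i) t *\<^sub>R y i)"
      using A by (intro simple_function_compose1[where g="\<lambda>c. c *\<^sub>R y i"] simple_function_indicator) auto
    moreover have "simple_function (lebesgue_on {0..1}) (\<lambda>t. \<Sum>i\<in>I. indicat_real (A i) t *\<^sub>R y i)"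
      using insert by blast
    ultimately have "simple_function (lebesgue_on {0..1})
        (\<lambda>t. indicat_real (A i) t *\<^sub>R y i + (\<Sum>i\<in>I. indicat_real (A i) t *\<^sub>R y i))"
      by (rule simple_function_compose2[where h="(+)"])
    then show ?case
      by (simp only: sum.insert[OF insert(1,2)])
  qed simp
  then have "simple_function (lebesgue_on {0..1}) (\<lambda>t. \<Sum>i=1..n. indicat_real (A i) t *\<^sub>R y i)"
    by blast
  moreover have "simple_function (lebesgue_on {0..1}) \<beta> \<longleftrightarrow>
      simple_function (lebesgue_on {0..1}) (\<lambda>t. \<Sum>i=1..n. indicat_real (A i) t *\<^sub>R y i)"
    by (rule simple_function_cong) (use \<beta> in simp)
  ultimately show "simple_function (lebesgue_on {0..1}) \<beta>"
    by blast
next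
  assume s: "simple_function (lebesgue_on {0..1}) \<beta>"
  define n where "n = card (\<beta> ` {0..1})"
  have fin: "finite (\<beta> ` {0..1})"
    using simple_functionD(1)[OF s] by simp
  then obtain y where y: "bij_betw y {1..n} (\<beta> ` {0..1})"
    unfolding n_def using ex_bij_betw_nat_finite_1 by blast
  define A where "A i = \<beta> -` {y i} \<inter> {0..1}" for i
  have "\<beta> t = (\<Sum>i=1..n. indicat_real (A i) t *\<^sub>R y i)" if t: "t \<in> {0..1}" for t
  proof -
    obtain j where j: "j \<in> {1..n}" "y j = \<beta> t"
      using y t unfolding bij_betw_def by (metis image_iff)
    \<comment> \<open>The enumeration \<open>y\<close> is injective, so \<open>t\<close> lies in
      exactly one fibre and a single summand survives.\<close>
    have "(\<Sum>i=1..n. indicat_real (A i) t *\<^sub>R y i) = (\<Sum>i=1..n. if i = j then \<beta> t else 0)"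
    proof (rule sum.cong)
      fix i assume i: "i \<in> {1..n}"
      have "t \<in> A i \<longleftrightarrow> y i = y j"
        using j(2) t by (auto simp: A_def)
      also have "\<dots> \<longleftrightarrow> i = j"
        by (rule inj_on_eq_iff[OF bij_betw_imp_inj_on[OF y] i j(1)])
      finally have "t \<in> A i \<longleftrightarrow> i = j" .
      then show "indicat_real (A i) t *\<^sub>R y i = (if i = j then \<beta> t else 0)"
        using j(2) by (auto simp: indicator_def)
    qed simp
    then show ?thesis
      using j(1) by simp
  qed
  moreover have "A i \<in> sets (lebesgue_on {0..1})" for i
    using simple_functionD(2)[OF s, of "{y i}"] by (simp add: A_def)
  ultimately show "\<beta> \<in> simple_functions"
    unfolding simple_functions_def by blast
qed

text \<open>By inner regularity each of the finitely many fibres contains a compact set of almost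
  full measure. The function is constant on each of these closed sets, hence continuous on their
  finite union.\<close>

lemma simple_function_imp_lusin_measurable:
  fixes \<beta> :: "real \<Rightarrow> 'e::locally_convex_space"
  assumes s: "simple_function (lebesgue_on {0..1}) \<beta>"
  shows "lusin_measurable \<beta>"
  unfolding lusin_measurable_def
proof safe
  fix e :: real assume e: "0 < e"
  define Y where "Y = \<beta> ` {0..1}"
  \<comment> \<open>Nonemptiness makes \<open>card Y\<close> positive, so that the error
    \<open>e\<close> can be divided equally among the fibres.\<close>
  have fin: "finite Y" and "Y \<noteq> {}"
    using simple_functionD(1)[OF s] by (auto simp: Y_def)
  then have c: "0 < card Y"
    by (simp add: card_gt_0_iff)
  define A where "A y = \<beta> -` {y} \<inter> {0..1}" for y
  have "\<exists>K. compact K \<and> K \<subseteq> A y \<and> A y - K \<in> lmeasurable \<and> measure lebesgue (A y - K) \<le> e / card Y" for y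
  proof -
    have "A y \<in> sets lebesgue"
      using simple_functionD(2)[OF s, of "{y}"] by (simp add: A_def sets_lebesgue_unit_interval)
    then obtain K where K: "closed K" "K \<subseteq> A y" "A y - K \<in> lmeasurable"
        "emeasure lebesgue (A y - K) < ennreal (e / card Y)"
      using sets_lebesgue_inner_closed[of "A y" "e / card Y"] e c by auto
    have "bounded K"
      using K(2) by (intro bounded_subset[of "{0..1}" K]) (auto simp: A_def)
    moreover have "measure lebesgue (A y - K) \<le> e / card Y"
      using K(3,4) e by (simp add: emeasure_eq_measure2 ennreal_less_iff)
    ultimately show ?thesis
      using K compact_eq_bounded_closed by blast
  qed
  then obtain K where K: "\<And>y. compact (K y)" "\<And>y. K y \<subseteq> A y" "\<And>y. A y - K y \<in> lmeasurable"
      "\<And>y. measure lebesgue (A y - K y) \<le> e / card Y"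
    by metis
  have "{0..1} - (\<Union>y\<in>Y. K y) = (\<Union>y\<in>Y. A y - K y)"
    using K(2) by (fastforce simp: A_def Y_def)
  then have "measure lebesgue ({0..1} - (\<Union>y\<in>Y. K y)) \<le> (\<Sum>y\<in>Y. measure lebesgue (A y - K y))"
    using K(3) fin by (auto intro!: measure_UNION_le)
  also have "\<dots> \<le> (\<Sum>y\<in>Y. e / card Y)"
    using K(4) by (intro sum_mono) auto
  also have "\<dots> = e"
    using c by simp
  finally have "measure lebesgue ({0..1} - (\<Union>y\<in>Y. K y)) \<le> e" .
  moreover have "continuous_on (\<Union>y\<in>Y. K y) \<beta>"
  proof (rule continuous_on_closed_Union[OF fin])
    show "closed (K y)" for y
      using K(1) by (rule compact_imp_closed)
    have "\<beta> t = y" if "t \<in> K y" for t y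
      using K(2) that by (auto simp: A_def)
    then show "continuous_on (K y) \<beta>" for y
      by (subst continuous_on_cong[OF refl, of _ _ "\<lambda>_. y"]) auto
  qed
  moreover have "(\<Union>y\<in>Y. K y) \<subseteq> {0..1}"
    using K(2) by (auto simp: A_def)
  ultimately show "\<exists>K. compact K \<and> K \<subseteq> {0..1} \<and> measure lebesgue ({0..1} - K) \<le> e \<and>
      continuous_on K \<beta>"
    using K(1) fin by (intro exI[of _ "\<Union>y\<in>Y. K y"]) auto
qed

text \<open>Any real function of a simple function takes finitely many values on [0,1], so it is
  bounded and measurable, hence integrable for a finite measure. This is applied to the p-th power
  of \<open>q\<close>.\<close>

lemma simple_functions_subset_Lp_functions:
  "(simple_functions :: (real \<Rightarrow> 'e::locally_convex_space) set) \<subseteq> Lp_functions p"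
proof
  fix \<beta> :: "real \<Rightarrow> 'e" assume "\<beta> \<in> simple_functions"
  then have s: "simple_function (lebesgue_on {0..1}) \<beta>"
    by (simp add: simple_functions_iff)
  have comp: "simple_function (lebesgue_on {0..1}) (\<lambda>t. h (\<beta> t))" for h :: "'e \<Rightarrow> real"
    using simple_function_compose1[OF s, of h] .
  have int: "integrable (lebesgue_on {0..1}) (\<lambda>t. h (\<beta> t))" for h :: "'e \<Rightarrow> real"
  proof -
    interpret finite_measure "lebesgue_on {0..1::real}"
      by (rule finite_measure_unit_interval)
    have "finite ((\<lambda>t. h (\<beta> t)) ` {0..1})"
      using simple_functionD(1)[OF comp[of h]] by simp
    then have "bounded ((\<lambda>t. h (\<beta> t)) ` {0..1})"
      by (rule finite_imp_bounded)
    then obtain B where "\<forall>t\<in>{0..1}. norm (h (\<beta> t)) \<le> B"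
      by (auto simp: bounded_iff)
    then show ?thesis
      using borel_measurable_simple_function[OF comp[of h]]
      by (intro integrable_const_bound[of _ B]) auto
  qed
  have "(\<lambda>t. q (\<beta> t)) \<in> real_Lp_functions p" for q
    using int[of "\<lambda>x. \<bar>q x\<bar> powr p"] borel_measurable_simple_function[OF comp[of q]]
    by (simp add: real_Lp_functions_def)
  then show "\<beta> \<in> Lp_functions p"
    using simple_function_imp_lusin_measurable[OF s] by (simp add: Lp_functions_def)
qed

section \<open>Vector-valued p-integrable functions and their seminorms\<close>

lemma Lp_functionsD:
  assumes "\<gamma> \<in> Lp_functions p" "continuous_seminorm q"
  shows "(\<lambda>t. q (\<gamma> t)) \<in> borel_measurable (lebesgue_on {0..1})"
    and "integrable (lebesgue_on {0..1}) (\<lambda>t. q (\<gamma> t) powr p)"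
proof -
  have *: "(\<lambda>t. q (\<gamma> t)) \<in> real_Lp_functions p"
    using assms unfolding Lp_functions_def by blast
  then show "(\<lambda>t. q (\<gamma> t)) \<in> borel_measurable (lebesgue_on {0..1})"
    by (simp add: real_Lp_functions_def)
  show "integrable (lebesgue_on {0..1}) (\<lambda>t. q (\<gamma> t) powr p)"
    using * continuous_seminormD(1)[OF assms(2)] by (simp add: real_Lp_functions_def)
qed

lemma Lp_functions_diff:
  assumes "1 \<le> p" "\<gamma> \<in> Lp_functions p" "\<eta> \<in> Lp_functions p"
  shows "(\<lambda>t. \<gamma> t - \<eta> t) \<in> Lp_functions p"
proof -
  have lusin: "lusin_measurable (\<lambda>t. \<gamma> t - \<eta> t)"
    using assms by (auto simp: Lp_functions_def intro: lusin_measurable_diff)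
  have "(\<lambda>t. q (\<gamma> t - \<eta> t)) \<in> real_Lp_functions p" if q: "continuous_seminorm q" for q
  proof -
    note nonneg = continuous_seminormD(1)[OF q]
    have meas[measurable]: "(\<lambda>t. q (\<gamma> t - \<eta> t)) \<in> borel_measurable (lebesgue_on {0..1})"
      by (rule lusin_measurable_imp_borel_measurable[OF lusin continuous_seminormD(4)[OF q]])
    \<comment> \<open>An integrable majorant: the bound of \<open>powr_add_le\<close> with
      \<open>a = b = 1\<close>, multiplied by \<open>2 powr p\<close> to undo the division by
      2.\<close>
    let ?g = "\<lambda>t. 2 powr p * (1 / 2 * q (\<gamma> t) powr p + 1 / 2 * q (\<eta> t) powr p)"
    have "integrable (lebesgue_on {0..1}) (\<lambda>t. q (\<gamma> t - \<eta> t) powr p)"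
    proof (rule Bochner_Integration.integrable_bound[of _ ?g])
      show "integrable (lebesgue_on {0..1}) ?g"
        using Lp_functionsD(2)[OF assms(2) q] Lp_functionsD(2)[OF assms(3) q]
        by (intro integrable_mult_right Bochner_Integration.integrable_add)
      have "q (\<gamma> t - \<eta> t) powr p \<le> ?g t" for t
      proof -
        have "q (\<gamma> t - \<eta> t) powr p \<le> (q (\<gamma> t) + q (\<eta> t)) powr p"
          using continuous_seminorm_diff[OF q] nonneg assms(1) by (intro powr_mono2) auto
        also have "\<dots> = 2 powr p * ((q (\<gamma> t) + q (\<eta> t)) / (1 + 1)) powr p"
          using nonneg by (simp add: powr_divide)
        also have "\<dots> \<le> ?g t"
          using powr_add_le[of p 1 1 "q (\<gamma> t)" "q (\<eta> t)"] nonneg assms(1)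
          by (intro mult_left_mono) auto
        finally show ?thesis .
      qed
      then show "AE t in lebesgue_on {0..1}. norm (q (\<gamma> t - \<eta> t) powr p) \<le> norm (?g t)"
        by (intro AE_I2) (simp add: order_trans[OF _ abs_ge_self])
    qed measurable
    then show ?thesis
      using meas nonneg by (simp add: real_Lp_functions_def)
  qed
  then show ?thesis
    using lusin by (simp add: Lp_functions_def)
qed

text \<open>Moves strict bounds between the seminorm and the integral, so that the later estimates
  handle no p-th roots.\<close>

lemma Lp_seminorm_less_iff:
  assumes "1 \<le> p" "0 < a"
  shows "Lp_seminorm p q \<gamma> < a \<longleftrightarrow> (LINT t|lebesgue_on {0..1}. q (\<gamma> t) powr p) < a powr p"
proof -
  have "0 \<le> (LINT t|lebesgue_on {0..1}. q (\<gamma> t) powr p)" (is "0 \<le> ?I")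
    by simp
  moreover have "a = (a powr p) powr (1 / p)"
    using assms by (simp add: powr_powr)
  ultimately show ?thesis
    unfolding Lp_seminorm_def using assms powr_mono2[of "1 / p" "a powr p" ?I]
      powr_less_mono2[of "1 / p" ?I "a powr p"] by (smt (verit) powr_ge_zero zero_less_divide_1_iff)
qed

text \<open>Minkowski's inequality, stated through strict positive upper bounds. Normalising by
  \<open>a\<close> and \<open>b\<close> instead of by the seminorms themselves avoids dividing by a
  seminorm that may vanish.\<close>

lemma Lp_seminorm_add_less:
  assumes p: "1 \<le> p" and q: "continuous_seminorm q"
    and "\<gamma> \<in> Lp_functions p" "\<eta> \<in> Lp_functions p"
    and ab: "0 < a" "0 < b" and less: "Lp_seminorm p q \<gamma> < a" "Lp_seminorm p q \<eta> < b"
  shows "Lp_seminorm p q (\<lambda>t. \<gamma> t + \<eta> t) < a + b"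
proof -
  let ?I = "integral\<^sup>L (lebesgue_on {0..1::real})"
  note nonneg = continuous_seminormD(1)[OF q]
  have int: "integrable (lebesgue_on {0..1}) (\<lambda>t. q (\<gamma> t) powr p)"
      "integrable (lebesgue_on {0..1}) (\<lambda>t. q (\<eta> t) powr p)"
    using assms Lp_functionsD(2) by blast+
  have I: "?I (\<lambda>t. q (\<gamma> t) powr p) < a powr p" "?I (\<lambda>t. q (\<eta> t) powr p) < b powr p"
    using less ab p Lp_seminorm_less_iff by blast+
  \<comment> \<open>The coefficients that \<open>powr_add_le\<close> yields after expansion; they
    satisfy \<open>c * a powr p + d * b powr p = (a + b) powr p\<close>.\<close>
  define c where "c = (a + b) powr p * (a / (a + b)) / a powr p"
  define d where "d = (a + b) powr p * (b / (a + b)) / b powr p"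
  have cd: "0 < c" "0 < d"
    using ab by (simp_all add: c_def d_def)
  have "q (\<gamma> t + \<eta> t) powr p \<le> c * q (\<gamma> t) powr p + d * q (\<eta> t) powr p" for t
  proof -
    have "q (\<gamma> t + \<eta> t) powr p \<le> (q (\<gamma> t) + q (\<eta> t)) powr p"
      using continuous_seminormD(2)[OF q] nonneg p by (intro powr_mono2) auto
    also have "\<dots> = (a + b) powr p * ((q (\<gamma> t) + q (\<eta> t)) / (a + b)) powr p"
      using nonneg ab by (simp add: powr_mult[symmetric])
    also have "\<dots> \<le> (a + b) powr p *
        (a / (a + b) * (q (\<gamma> t) / a) powr p + b / (a + b) * (q (\<eta> t) / b) powr p)"
      using powr_add_le[OF p ab nonneg nonneg] by (intro mult_left_mono) auto
    also have "\<dots> = c * q (\<gamma> t) powr p + d * q (\<eta> t) powr p"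
      using ab nonneg by (simp add: c_def d_def powr_divide distrib_left)
    finally show ?thesis .
  qed
  then have "?I (\<lambda>t. q (\<gamma> t + \<eta> t) powr p) \<le> ?I (\<lambda>t. c * q (\<gamma> t) powr p + d * q (\<eta> t) powr p)"
    using cd by (intro integral_mono' Bochner_Integration.integrable_add integrable_mult_right int) auto
  also have "\<dots> = c * ?I (\<lambda>t. q (\<gamma> t) powr p) + d * ?I (\<lambda>t. q (\<eta> t) powr p)"
    using int by simp
  also have "\<dots> < c * a powr p + d * b powr p"
    using I cd by (intro add_strict_mono mult_strict_left_mono)
  also have "\<dots> = (a + b) powr p * (a / (a + b) + b / (a + b))"
    using ab by (simp add: c_def d_def distrib_left)
  also have "\<dots> = (a + b) powr p"
    using ab by (simp add: add_divide_distrib[symmetric])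
  finally show ?thesis
    using Lp_seminorm_less_iff[OF p add_pos_pos[OF ab]] by blast
qed

lemma Lp_seminorm_mono:
  assumes "1 \<le> p" "continuous_seminorm q" "continuous_seminorm q'" "\<And>x. q x \<le> q' x"
    and "\<gamma> \<in> Lp_functions p"
  shows "Lp_seminorm p q \<gamma> \<le> Lp_seminorm p q' \<gamma>"
proof -
  have "(LINT t|lebesgue_on {0..1}. q (\<gamma> t) powr p) \<le> (LINT t|lebesgue_on {0..1}. q' (\<gamma> t) powr p)"
    using assms(1,4) continuous_seminormD(1)[OF assms(2)]
    by (intro integral_mono Lp_functionsD(2)[OF assms(5)] assms(2,3) powr_mono2) auto
  then show ?thesis
    unfolding Lp_seminorm_def using assms(1) by (intro powr_mono2) auto
qed

text \<open>Lets a bound pass from one representative of a class to another.\<close>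

lemma Lp_seminorm_cong_AE:
  assumes p: "1 \<le> p" and q: "continuous_seminorm q"
    and "\<gamma> \<in> Lp_functions p" "\<eta> \<in> Lp_functions p" "AE t in lebesgue_on {0..1}. \<gamma> t = \<eta> t"
  shows "Lp_seminorm p q \<gamma> = Lp_seminorm p q \<eta>"
proof -
  have "(LINT t|lebesgue_on {0..1}. q (\<gamma> t) powr p) = (LINT t|lebesgue_on {0..1}. q (\<eta> t) powr p)"
  proof (rule integral_cong_AE)
    show "AE t in lebesgue_on {0..1}. q (\<gamma> t) powr p = q (\<eta> t) powr p"
      using assms(5) by eventually_elim simp
  qed (use assms Lp_functionsD(2) in blast)+
  then show ?thesis
    by (simp add: Lp_seminorm_def)
qed

section \<open>Approximation by simple functions\<close>

text \<open>The cover by seminorm balls is pulled back to relatively open subsets of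
  \<open>K\<close>, so compactness is applied on the real line. Continuity of
  \<open>\<gamma>\<close> on \<open>K\<close> provides the openness.\<close>

lemma compact_simple_approximation:
  fixes \<gamma> :: "real \<Rightarrow> 'e::locally_convex_space"
  assumes q: "continuous_seminorm q" and K: "compact K" "K \<subseteq> {0..1}" "continuous_on K \<gamma>" and r: "0 < r"
  obtains \<beta> where "\<beta> \<in> simple_functions" "\<And>t. t \<in> K \<Longrightarrow> q (\<gamma> t - \<beta> t) < r"
    "\<And>t. t \<notin> K \<Longrightarrow> \<beta> t = 0"
proof -
  have "\<exists>V. open V \<and> V \<inter> K = (\<lambda>t. q (\<gamma> t - \<gamma> s)) -` {..<r} \<inter> K" for s
  proof -
    have "continuous_on K (\<lambda>t. q (\<gamma> t - \<gamma> s))"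
      by (rule continuous_on_compose2[OF continuous_seminormD(4)[OF q, of UNIV]])
        (auto intro!: continuous_on_diff K(3) continuous_on_const)
    then have "open {..<r} \<longrightarrow>
        (\<exists>V. open V \<and> V \<inter> K = (\<lambda>t. q (\<gamma> t - \<gamma> s)) -` {..<r} \<inter> K)"
      unfolding continuous_on_open_invariant by (rule spec)
    then show ?thesis
      by simp
  qed
  then obtain V where V: "\<And>s. open (V s)" "\<And>s. V s \<inter> K = (\<lambda>t. q (\<gamma> t - \<gamma> s)) -` {..<r} \<inter> K"
    by metis
  have "s \<in> V s" if "s \<in> K" for s
    using V(2)[of s] that r continuous_seminorm_zero[OF q] by auto
  then have "K \<subseteq> (\<Union>s\<in>K. V s)"
    by blast
  then obtain D where D: "finite D" "K \<subseteq> (\<Union>s\<in>D. V s)"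
    using compactE_image[OF K(1), of K V] V(1) by metis
  \<comment> \<open>Induction over the finite subcover, starting from the zero function, which
    accounts for the value 0 off \<open>K\<close>.\<close>
  have "\<exists>\<beta>. simple_function (lebesgue_on {0..1}) \<beta> \<and>
      (\<forall>t\<in>K \<inter> (\<Union>s\<in>D. V s). q (\<gamma> t - \<beta> t) < r) \<and> (\<forall>t. t \<notin> K \<longrightarrow> \<beta> t = 0)"
    using D(1)
  proof (induction D)
    case empty
    show ?case
      by (intro exI[of _ "\<lambda>_. 0"]) simp
  next
    case (insert s D)
    then obtain \<beta> where \<beta>: "simple_function (lebesgue_on {0..1}) \<beta>"
        "\<forall>t\<in>K \<inter> (\<Union>s\<in>D. V s). q (\<gamma> t - \<beta> t) < r" "\<forall>t. t \<notin> K \<longrightarrow> \<beta> t = 0"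
      by blast
    have "V s \<inter> K \<in> sets borel"
      using V(1) K(1) by (intro sets.Int borel_open borel_compact)
    then have "V s \<inter> K \<in> sets (lebesgue_on {0..1})"
      using K(2) by (auto simp: sets_lebesgue_unit_interval)
    moreover from this have "space (lebesgue_on {0..1}) \<inter> (V s \<inter> K) = V s \<inter> K"
      using K(2) by auto
    \<comment> \<open>Overwriting the earlier value on \<open>V s \<inter> K\<close> disjointifies
      the cover implicitly; on overlaps the newest centre prevails, and it is as close as
      required.\<close>
    ultimately have "simple_function (lebesgue_on {0..1}) (\<lambda>t. if t \<in> V s \<inter> K then \<gamma> s else \<beta> t)"
      using \<beta>(1) by (intro simple_function_If_set) auto
    moreover have "q (\<gamma> t - \<gamma> s) < r" if "t \<in> V s \<inter> K" for t
      using V(2)[of s] that by auto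
    ultimately show ?case
      using \<beta>(2,3) by (intro exI[of _ "\<lambda>t. if t \<in> V s \<inter> K then \<gamma> s else \<beta> t"]) auto
  qed
  then show thesis
    using D(2) that by (metis IntI simple_functions_iff subsetD)
qed

text \<open>The allowance \<open>e powr p\<close> is halved: off \<open>K\<close> the approximant is
  0 and the integral of \<open>q (\<gamma> t) powr p\<close> is small by absolute continuity; on
  \<open>K\<close> the integrand is at most \<open>r powr p\<close>.\<close>

lemma Lp_simple_approximation:
  fixes \<gamma> :: "real \<Rightarrow> 'e::locally_convex_space"
  assumes p: "1 \<le> p" and \<gamma>: "\<gamma> \<in> Lp_functions p" and e: "0 < e" and q: "continuous_seminorm q"
  obtains \<beta> where "\<beta> \<in> simple_functions" "Lp_seminorm p q (\<lambda>t. \<gamma> t - \<beta> t) < e"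
proof -
  interpret finite_measure "lebesgue_on {0..1::real}"
    by (rule finite_measure_unit_interval)
  note int = Lp_functionsD(2)[OF \<gamma> q]
  have e2: "0 < e powr p / 2"
    using e by simp
  obtain d where d: "0 < d" "\<And>A. A \<in> sets (lebesgue_on {0..1}) \<Longrightarrow>
      measure (lebesgue_on {0..1}) A \<le> d \<Longrightarrow>
      (LINT t|lebesgue_on {0..1}. indicator A t * q (\<gamma> t) powr p) < e powr p / 2"
    by (rule integral_absolutely_continuous[OF int powr_ge_zero e2]) blast
  obtain K where K: "compact K" "K \<subseteq> {0..1}" "measure lebesgue ({0..1} - K) \<le> d"
      "continuous_on K \<gamma>"
    using \<gamma> d(1) unfolding Lp_functions_def lusin_measurable_def by blast
  define A where "A = {0..1} - K"
  have A: "A \<in> sets (lebesgue_on {0..1})"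
    using borel_compact[OF K(1)] by (auto simp: sets_lebesgue_unit_interval A_def)
  have "measure (lebesgue_on {0..1}) A \<le> d"
    using K(3) by (simp add: A_def measure_restrict_space)
  then have small: "(LINT t|lebesgue_on {0..1}. indicator A t * q (\<gamma> t) powr p) < e powr p / 2"
    using d(2) A by blast
  \<comment> \<open>Chosen so that \<open>r powr p\<close> is half of \<open>e powr p\<close>; since
    [0,1] has measure 1, integrating this constant adds exactly that half.\<close>
  define r where "r = (e powr p / 2) powr (1 / p)"
  have r: "0 < r" "r powr p = e powr p / 2"
    using e p by (simp_all add: r_def powr_powr)
  obtain \<beta> where \<beta>: "\<beta> \<in> simple_functions" "\<And>t. t \<in> K \<Longrightarrow> q (\<gamma> t - \<beta> t) < r"
    "\<And>t. t \<notin> K \<Longrightarrow> \<beta> t = 0"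
    using compact_simple_approximation[OF q K(1,2,4) r(1)] by blast
  have intA: "integrable (lebesgue_on {0..1}) (\<lambda>t. indicator A t * q (\<gamma> t) powr p)"
    using integrable_mult_indicator[OF A int] by simp
  have "(LINT t|lebesgue_on {0..1}. q (\<gamma> t - \<beta> t) powr p) \<le>
      (LINT t|lebesgue_on {0..1}. indicator A t * q (\<gamma> t) powr p + r powr p)"
  proof (rule integral_mono')
    fix t assume t: "t \<in> space (lebesgue_on {0..1::real})"
    show "q (\<gamma> t - \<beta> t) powr p \<le> indicator A t * q (\<gamma> t) powr p + r powr p"
    proof (cases "t \<in> K")
      case True
      then have "q (\<gamma> t - \<beta> t) powr p \<le> r powr p"
        using \<beta>(2)[OF True] continuous_seminormD(1)[OF q] p by (intro powr_mono2) auto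
      then show ?thesis
        by (simp add: add_increasing)
    next
      case False
      then show ?thesis
        using t \<beta>(3) by (simp add: A_def)
    qed
  qed (auto simp: intA)
  also have "\<dots> = (LINT t|lebesgue_on {0..1}. indicator A t * q (\<gamma> t) powr p) + r powr p"
    using intA by (simp add: measure_restrict_space)
  also have "\<dots> < e powr p"
    using small r(2) by simp
  finally show thesis
    using that \<beta>(1) Lp_seminorm_less_iff[OF p e] by blast
qed

section \<open>The quotient by almost everywhere equality and its topology\<close>

lemma equiv_ae_eq:
  "equiv (Lp_functions p :: (real \<Rightarrow> 'e::locally_convex_space) set) (ae_eq p)"
proof (rule equivI)
  show "(ae_eq p :: ((real \<Rightarrow> 'e) \<times> _) set) \<subseteq> Lp_functions p \<times> Lp_functions p"
    by (auto simp: ae_eq_def)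
  show "refl_on (Lp_functions p :: (real \<Rightarrow> 'e) set) (ae_eq p)"
    by (auto simp: refl_on_def ae_eq_def)
  show "sym (ae_eq p :: ((real \<Rightarrow> 'e) \<times> _) set)"
    unfolding sym_def ae_eq_def by (auto elim: eventually_mono)
  show "trans (ae_eq p :: ((real \<Rightarrow> 'e) \<times> _) set)"
  proof (rule transI)
    fix \<gamma> \<eta> \<zeta> :: "real \<Rightarrow> 'e"
    assume *: "(\<gamma>, \<eta>) \<in> ae_eq p" "(\<eta>, \<zeta>) \<in> ae_eq p"
    then have "AE t in lebesgue_on {0..1}. \<gamma> t = \<eta> t" "AE t in lebesgue_on {0..1}. \<eta> t = \<zeta> t"
      by (simp_all add: ae_eq_def)
    then have "AE t in lebesgue_on {0..1}. \<gamma> t = \<zeta> t"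
      by eventually_elim simp
    then show "(\<gamma>, \<zeta>) \<in> ae_eq p"
      using * by (simp add: ae_eq_def)
  qed
qed

lemma Lp_class_eq_iff:
  assumes "\<gamma> \<in> Lp_functions p" "\<eta> \<in> Lp_functions p"
  shows "Lp_class p \<gamma> = Lp_class p \<eta> \<longleftrightarrow> (AE t in lebesgue_on {0..1}. \<gamma> t = \<eta> t)"
  unfolding Lp_class_def eq_equiv_class_iff[OF equiv_ae_eq assms] by (simp add: ae_eq_def assms)

lemma Lp_space_eq: "Lp_space p = Lp_class p ` Lp_functions p"
  by (simp add: Lp_space_def Lp_class_def[abs_def] quotient_def UNION_singleton_eq_range)

lemma topspace_Lp_topology: "topspace (Lp_topology p) = (Lp_space p :: (real \<Rightarrow> 'e::locally_convex_space) set set)"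
proof
  show "topspace (Lp_topology p) \<subseteq> (Lp_space p :: (real \<Rightarrow> 'e) set set)"
    by (auto simp: Lp_topology_def Lp_ball_def Lp_space_eq)
  \<comment> \<open>The zero seminorm puts every class into a subbasic ball, so the subbasis covers
    the whole quotient.\<close>
  have "continuous_seminorm (\<lambda>_::'e. 0)"
    by (simp add: continuous_seminorm_def)
  moreover have "Lp_class p \<gamma> \<in> Lp_ball p (\<lambda>_. 0) \<gamma> 1" if "\<gamma> \<in> Lp_functions p" for \<gamma> :: "real \<Rightarrow> 'e"
    using that by (simp add: Lp_ball_def Lp_seminorm_def)
  ultimately show "(Lp_space p :: (real \<Rightarrow> 'e) set set) \<subseteq> topspace (Lp_topology p)"
    unfolding Lp_topology_def topology_generated_by_topspace Lp_space_eq
    using zero_less_one by blast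
qed

text \<open>Induction on how \<open>T\<close> is generated from the subbasis. Finite intersections
  are handled by adding seminorms and taking the smaller radius, subbasic balls by recentring at
  \<open>\<gamma>\<close> with the triangle inequality.\<close>

lemma Lp_topology_seminorm_ball:
  assumes p: "1 \<le> p" and T: "openin (Lp_topology p) T" "Lp_class p \<gamma> \<in> T" and \<gamma>: "\<gamma> \<in> Lp_functions p"
  obtains q r where "continuous_seminorm q" "0 < r" "Lp_ball p q \<gamma> r \<subseteq> T"
proof -
  have "generate_topology_on {Lp_ball p q \<eta> r | q \<eta> r.
      continuous_seminorm q \<and> \<eta> \<in> Lp_functions p \<and> r > 0} T"
    using T(1) unfolding Lp_topology_def by (rule openin_topology_generated_by)
  then have "\<exists>q r. continuous_seminorm q \<and> 0 < r \<and> Lp_ball p q \<gamma> r \<subseteq> T"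
    using T(2)
  proof induction
    case Empty
    then show ?case by simp
  next
    case (Int S T)
    then obtain q r q' r' where q: "continuous_seminorm q" "continuous_seminorm q'"
      and r: "0 < r" "Lp_ball p q \<gamma> r \<subseteq> S" "0 < r'" "Lp_ball p q' \<gamma> r' \<subseteq> T"
      by (metis IntD1 IntD2)
    let ?q = "\<lambda>x. q x + q' x"
    note q'' = continuous_seminorm_add[OF q]
    have "Lp_seminorm p q (\<lambda>t. \<eta> t - \<gamma> t) \<le> Lp_seminorm p ?q (\<lambda>t. \<eta> t - \<gamma> t)"
         "Lp_seminorm p q' (\<lambda>t. \<eta> t - \<gamma> t) \<le> Lp_seminorm p ?q (\<lambda>t. \<eta> t - \<gamma> t)"
      if "\<eta> \<in> Lp_functions p" for \<eta>
      using continuous_seminormD(1)[OF q(1)] continuous_seminormD(1)[OF q(2)]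
      by (intro Lp_seminorm_mono p q q'' Lp_functions_diff that \<gamma>; simp)+
    then have "Lp_ball p ?q \<gamma> (min r r') \<subseteq> Lp_ball p q \<gamma> r \<inter> Lp_ball p q' \<gamma> r'"
      unfolding Lp_ball_def by fastforce
    then show ?case
      using r q'' by (intro exI[of _ ?q] exI[of _ "min r r'"]) auto
  next
    case (UN K)
    then obtain k where k: "k \<in> K" "Lp_class p \<gamma> \<in> k"
      by blast
    then obtain q r where "continuous_seminorm q" "0 < r" "Lp_ball p q \<gamma> r \<subseteq> k"
      using UN.IH by blast
    then show ?case
      using k(1) by (intro exI[of _ q] exI[of _ r]) blast
  next
    case (Basis S)
    then obtain q \<gamma>' r where S: "S = Lp_ball p q \<gamma>' r" and q: "continuous_seminorm q"
      and \<gamma>': "\<gamma>' \<in> Lp_functions p" and r: "0 < r"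
      by blast
    \<comment> \<open>Membership in a ball of classes supplies only some representative
      \<open>\<eta>\<close>; almost everywhere equality carries the bound over to
      \<open>\<gamma>\<close>.\<close>
    obtain \<eta> where \<eta>: "\<eta> \<in> Lp_functions p" "Lp_class p \<gamma> = Lp_class p \<eta>"
        "Lp_seminorm p q (\<lambda>t. \<eta> t - \<gamma>' t) < r"
      using Basis.prems unfolding S Lp_ball_def by blast
    have "AE t in lebesgue_on {0..1}. \<gamma> t = \<eta> t"
      using \<eta> \<gamma> Lp_class_eq_iff by blast
    then have "AE t in lebesgue_on {0..1}. \<gamma> t - \<gamma>' t = \<eta> t - \<gamma>' t"
      by eventually_elim simp
    then have "Lp_seminorm p q (\<lambda>t. \<gamma> t - \<gamma>' t) < r"
      using Lp_seminorm_cong_AE[OF p q Lp_functions_diff[OF p \<gamma> \<gamma>'] Lp_functions_diff[OF p \<eta>(1) \<gamma>']] \<eta>(3)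
      by simp
    \<comment> \<open>A strictly intermediate \<open>s\<close> is needed because
      \<open>Lp_seminorm_add_less\<close> takes strict positive bounds; the remaining
      \<open>r - s\<close> becomes the new radius.\<close>
    then obtain s where s: "Lp_seminorm p q (\<lambda>t. \<gamma> t - \<gamma>' t) < s" "s < r"
      using dense by blast
    have s0: "0 < s"
      using s(1) by (rule le_less_trans[rotated]) (simp add: Lp_seminorm_def)
    have "Lp_ball p q \<gamma> (r - s) \<subseteq> S"
    proof -
      have "Lp_seminorm p q (\<lambda>t. \<zeta> t - \<gamma>' t) < r"
        if "\<zeta> \<in> Lp_functions p" "Lp_seminorm p q (\<lambda>t. \<zeta> t - \<gamma> t) < r - s" for \<zeta>
        using Lp_seminorm_add_less[OF p q Lp_functions_diff[OF p that(1) \<gamma>]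
            Lp_functions_diff[OF p \<gamma> \<gamma>'] _ s0 that(2) s(1)] s(2) by simp
      then show ?thesis
        unfolding S Lp_ball_def by blast
    qed
    then show ?case
      using q s(2) by (intro exI[of _ q] exI[of _ "r - s"]) simp
  qed
  then show thesis
    using that by blast
qed

theorem theorem3p5:
  fixes p :: real
  assumes "1 \<le> p"
  shows "(\<forall>\<gamma> \<in> (Lp_functions p :: (real \<Rightarrow> 'e::locally_convex_space) set).
            \<forall>\<epsilon>>0. \<forall>q. continuous_seminorm q \<longrightarrow>
              (\<exists>\<beta> \<in> simple_functions. Lp_seminorm p q (\<lambda>t. \<gamma> t - \<beta> t) < \<epsilon>)) \<and>
         (simple_functions :: (real \<Rightarrow> 'e) set) \<subseteq> Lp_functions p \<and>
         Lp_topology p closure_of (Lp_class p ` (simple_functions :: (real \<Rightarrow> 'e) set)) = Lp_space p"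
proof (intro conjI ballI allI impI)
  fix \<gamma> :: "real \<Rightarrow> 'e" and \<epsilon> :: real and q :: "'e \<Rightarrow> real"
  assume "\<gamma> \<in> Lp_functions p" "\<epsilon> > 0" "continuous_seminorm q"
  then show "\<exists>\<beta> \<in> simple_functions. Lp_seminorm p q (\<lambda>t. \<gamma> t - \<beta> t) < \<epsilon>"
    by (auto elim: Lp_simple_approximation[OF assms])
next
  show "(simple_functions :: (real \<Rightarrow> 'e) set) \<subseteq> Lp_functions p"
    by (rule simple_functions_subset_Lp_functions)
next
  have "\<exists>\<xi> \<in> Lp_class p ` simple_functions. \<xi> \<in> T"
    if \<gamma>: "\<gamma> \<in> Lp_functions p" and T: "Lp_class p \<gamma> \<in> T" "openin (Lp_topology p) T"
    for \<gamma> :: "real \<Rightarrow> 'e" and T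
  proof -
    obtain q r where q: "continuous_seminorm q" and r: "0 < r" and ball: "Lp_ball p q \<gamma> r \<subseteq> T"
      using Lp_topology_seminorm_ball[OF assms T(2,1) \<gamma>] .
    obtain \<beta> where \<beta>: "\<beta> \<in> simple_functions" "Lp_seminorm p q (\<lambda>t. \<gamma> t - \<beta> t) < r"
      using Lp_simple_approximation[OF assms \<gamma> r q] .
    \<comment> \<open>The approximation bounds \<open>\<gamma> - \<beta>\<close>, whereas balls
      measure the point minus the centre, so the sign is reversed.\<close>
    have "q (\<gamma> t - \<beta> t) = q (\<beta> t - \<gamma> t)" for t
      using continuous_seminorm_minus[OF q, of "\<gamma> t - \<beta> t"] by simp
    then have "Lp_seminorm p q (\<lambda>t. \<beta> t - \<gamma> t) < r"
      using \<beta>(2) by (simp add: Lp_seminorm_def)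
    then have "Lp_class p \<beta> \<in> Lp_ball p q \<gamma> r"
      using \<beta>(1) simple_functions_subset_Lp_functions unfolding Lp_ball_def by blast
    then show ?thesis
      using ball \<beta>(1) by blast
  qed
  then show "Lp_topology p closure_of (Lp_class p ` (simple_functions :: (real \<Rightarrow> 'e) set)) = Lp_space p"
    unfolding closure_of_def topspace_Lp_topology by (auto simp: Lp_space_eq)
qed

end
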